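(* Let $n,m\ge 2$ be integers and let the parameters $a_i,\bar a_i$ $(1\le i\le n+m)$ and the quantities $d,r,\rho$ be as in the context. Then there exists a solution $(\lambda,x)$, with $\lambda\in\mathbb{R}$ and $x=(x_1,x_n,x_{n+1},x_{n+m})\in\mathbb{R}^4$, of the system $(S)$ written in the context such that $\lambda$ satisfies $$0=\max\Big\{\min\big\{d-(1+\rho)\lambda,\ \tfrac14-\lambda,\ r-d-(2r-1+\rho)\lambda\big\},\ -\lambda\Big\}.$$
   Context: All formulas are in ordinary real arithmetic (the min-plus notation of the source has been expanded). Parameters: $n,m\ge 2$ are integers; $a_1,\dots,a_{n+m}$ are real numbers with $0\le a_i\le 1$ for all $i$ and $a_n+a_{n+m}\le 1$. Put $\bar a_i=1-a_i$ for $i\ne n,n+m$, and $\bar a_n=\bar a_{n+m}=1-a_n-a_{n+m}$. Put $$b=\sum_{i=1}^{n-1}a_i,\quad \bar b=\sum_{i=1}^{n-1}\bar a_i,\quad b'=\sum_{i=n+1}^{n+m-1}a_i,\quad \bar b'=\sum_{i=n+1}^{n+m-1}\bar a_i ,$$ $$d=\frac{1}{n+m-1}\sum_{i=1}^{n+m}a_i,\qquad r=\frac{n}{n+m-1},\qquad \rho=\frac{1}{n+m-1}.$$ System $(S)$ (unknowns $\lambda,x_1,x_n,x_{n+1},x_{n+m}\in\mathbb{R}$): $$x_n=\min\{\bar a_n-2\lambda+x_1+x_{n+1}-x_{n+m},\ b-(n-1)\lambda+x_1\},$$ $$x_{n+m}=\min\{\bar a_{n+m}-\lambda+x_1+x_{n+1}-x_n,\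 b'-(m-1)\lambda+x_{n+1}\},$$ $$x_1=\min\{a_n-\lambda+\tfrac12(x_n+x_{n+m}),\ \bar b-(n-1)\lambda+x_n\},$$ $$x_{n+1}=\min\{a_{n+m}-\lambda+\tfrac12(x_n+x_{n+m}),\ \bar b'-(m-1)\lambda+x_{n+m}\}.$$ *)

theory Defs
  imports Complex_Main
begin

definition abar :: "nat \<Rightarrow> nat \<Rightarrow> (nat \<Rightarrow> real) \<Rightarrow> nat \<Rightarrow> real" where
  "abar n m a i = (if i = n \<or> i = n + m then 1 - a n - a (n + m) else 1 - a i)"

definition valid_params :: "nat \<Rightarrow> nat \<Rightarrow> (nat \<Rightarrow> real) \<Rightarrow> bool" where
  "valid_params n m a \<longleftrightarrow>
     n \<ge> 2 \<and> m \<ge> 2 \<and> (\<forall>i\<in>{1..n + m}. 0 \<le> a i \<and> a i \<le> 1) \<and> a n + a (n + m) \<le> 1"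

text \<open>In the names below, a final \<open>1\<close> refers to the indices \<open>1..n-1\<close> and a final \<open>2\<close> (primed
  quantities) to the indices \<open>n+1..n+m-1\<close>.\<close>

definition b1 :: "nat \<Rightarrow> nat \<Rightarrow> (nat \<Rightarrow> real) \<Rightarrow> real" where
  "b1 n m a = (\<Sum>i = 1..n - 1. a i)"

definition bbar1 :: "nat \<Rightarrow> nat \<Rightarrow> (nat \<Rightarrow> real) \<Rightarrow> real" where
  "bbar1 n m a = (\<Sum>i = 1..n - 1. abar n m a i)"

definition b2 :: "nat \<Rightarrow> nat \<Rightarrow> (nat \<Rightarrow> real) \<Rightarrow> real" where
  "b2 n m a = (\<Sum>i = n + 1..n + m - 1. a i)"

definition bbar2 :: "nat \<Rightarrow> nat \<Rightarrow> (nat \<Rightarrow> real) \<Rightarrow> real" where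
  "bbar2 n m a = (\<Sum>i = n + 1..n + m - 1. abar n m a i)"

definition density :: "nat \<Rightarrow> nat \<Rightarrow> (nat \<Rightarrow> real) \<Rightarrow> real" where
  "density n m a = 1 / (real n + real m - 1) * (\<Sum>i = 1..n + m. a i)"

definition ratio :: "nat \<Rightarrow> nat \<Rightarrow> real" where
  "ratio n m = real n / (real n + real m - 1)"

definition rho :: "nat \<Rightarrow> nat \<Rightarrow> real" where
  "rho n m = 1 / (real n + real m - 1)"

text \<open>The unknowns \<open>x1, xn, xn1, xnm\<close> stand for $x_1, x_n, x_{n+1}, x_{n+m}$.\<close>

definition solves_S ::
    "nat \<Rightarrow> nat \<Rightarrow> (nat \<Rightarrow> real) \<Rightarrow> real \<Rightarrow> real \<times> real \<times> real \<times> real \<Rightarrow> bool" where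
  "solves_S n m a lam x \<longleftrightarrow> (case x of (x1, xn, xn1, xnm) \<Rightarrow>
     xn = min (abar n m a n - 2 * lam + x1 + xn1 - xnm)
              (b1 n m a - (real n - 1) * lam + x1) \<and>
     xnm = min (abar n m a (n + m) - lam + x1 + xn1 - xn)
               (b2 n m a - (real m - 1) * lam + xn1) \<and>
     x1 = min (a n - lam + 1 / 2 * (xn + xnm))
              (bbar1 n m a - (real n - 1) * lam + xn) \<and>
     xn1 = min (a (n + m) - lam + 1 / 2 * (xn + xnm))
               (bbar2 n m a - (real m - 1) * lam + xnm))"

end

(* The system is invariant under adding a constant to all unknowns, so one may put x_n = -t and
   x_{n+m} = t. For 0 < lambda <= 1/4 the equation for x_{n+m} can only be attained by its second
   term, which forces t = a_{n+m} + b' - m lambda; substituting this into the equation for x_n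
   leaves the equation min (...) = 0 for lambda alone, up to the factors n+m-1 and 4. That equation
   has a root in (0, 1/4] by the intermediate value theorem unless the minimum is already <= 0 at
   lambda = 0, that is, unless the sum s of all a_i is 0 or at least n. The case s = 0 is covered by
   the same solution, and for s >= n a different t solves the system with lambda = 0. *)

theory Submission
  imports Defs
begin

lemma bbar1_eq:
  assumes "n \<ge> 1"
  shows "bbar1 n m a = real n - 1 - b1 n m a"
proof -
  have "bbar1 n m a = (\<Sum>i = 1..n - 1. 1 - a i)"
    unfolding bbar1_def by (rule sum.cong) (auto simp: abar_def)
  then show ?thesis
    using assms by (simp add: sum_subtractf b1_def of_nat_diff)
qed

lemma bbar2_eq:
  assumes "m \<ge> 1"
  shows "bbar2 n m a = real m - 1 - b2 n m a"
proof -
  have "bbar2 n m a = (\<Sum>i = n + 1..n + m - 1. 1 - a i)"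
    unfolding bbar2_def by (rule sum.cong) (auto simp: abar_def)
  then show ?thesis
    using assms by (simp add: sum_subtractf b2_def of_nat_diff)
qed

lemma sum_params_split:
  assumes "n \<ge> 1" "m \<ge> 1"
  shows "(\<Sum>i = 1..n + m. a i) = b1 n m a + b2 n m a + a n + a (n + m)"
proof -
  obtain k l where k: "n = Suc k" and l: "m = Suc l"
    using assms by (metis Suc_le_D One_nat_def)
  have "(\<Sum>i = 1..n + m. a i) = (\<Sum>i = 1..n + l. a i) + a (n + m)"
    by (simp add: l)
  also have "(\<Sum>i = 1..n + l. a i) = (\<Sum>i = 1..n. a i) + (\<Sum>i = n + 1..n + l. a i)"
    by (rule sum.ub_add_nat) simp
  also have "(\<Sum>i = 1..n. a i) = (\<Sum>i = 1..k. a i) + a n"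
    by (simp add: k)
  finally show ?thesis
    by (simp add: b1_def b2_def k l)
qed

text \<open>\<open>a n + a (n + m) \<le> 1\<close> lets these two terms count as one, hence the -
  1.\<close>

lemma sum_params_bounds:
  assumes "valid_params n m a"
  shows "0 \<le> (\<Sum>i = 1..n + m. a i)" "(\<Sum>i = 1..n + m. a i) \<le> real n + real m - 1"
proof -
  have nm: "n \<ge> 2" "m \<ge> 2" and a: "\<And>i. i \<in> {1..n + m} \<Longrightarrow> 0 \<le> a i \<and> a i \<le> 1"
    and c: "a n + a (n + m) \<le> 1"
    using assms by (auto simp: valid_params_def)
  show "0 \<le> (\<Sum>i = 1..n + m. a i)"
    using a by (intro sum_nonneg) blast
  have "b1 n m a \<le> (\<Sum>i = 1..n - 1. 1)" "b2 n m a \<le> (\<Sum>i = n + 1..n + m - 1. 1)"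
    unfolding b1_def b2_def using nm by (intro sum_mono; use a in auto)+
  then show "(\<Sum>i = 1..n + m. a i) \<le> real n + real m - 1"
    using nm c sum_params_split[of n m a] by (simp add: of_nat_diff)
qed

text \<open>As \<open>xn + xnm = 0\<close>, the equation for \<open>x1\<close> holds by the choice
  of \<open>x1\<close>. In the equation for \<open>xn\<close>, after adding \<open>t\<close>, the
  two branches of \<open>x1\<close> turn the first term into the last two terms of
  \<open>root\<close>, and the second term into the first term of \<open>root\<close> or (n - 1)(1 -
  2 lambda).\<close>

lemma solves_S_if_root:
  fixes lam :: real
  assumes "n \<ge> 1" "m \<ge> 1"
    and s: "s = (\<Sum>i = 1..n + m. a i)"
    and lam: "0 \<le> lam" "lam \<le> 1 / 4"
    and root: "min (s - (real n + real m) * lam)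
      (min (1 - 4 * lam) (real n - s - (real n - real m + 2) * lam)) = 0"
  defines "t \<equiv> a (n + m) + b2 n m a - real m * lam"
  shows "solves_S n m a lam
    (min (a n - lam) (bbar1 n m a - (real n - 1) * lam - t), - t, a (n + m) - lam, t)"
proof -
  \<comment> \<open>The first product is that extra term for \<open>xn\<close>; the second is the
    gap between the two terms for \<open>xn1\<close>.\<close>
  have "0 \<le> (real n - 1) * (1 - 2 * lam)" "0 \<le> (real m - 1) * (1 - 2 * lam)"
    using assms by (auto intro!: mult_nonneg_nonneg)
  then have "0 \<le> real n - 1 - 2 * ((real n - 1) * lam)" "0 \<le> real m - 1 - 2 * ((real m - 1) * lam)"
    by (simp_all add: algebra_simps)
  then show ?thesis
    using lam root sum_params_split[of n m a] assms(1,2)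
    unfolding solves_S_def t_def s
    by (auto simp: bbar1_eq bbar2_eq abar_def algebra_simps min_def split: if_splits)
qed

text \<open>Here the first terms for \<open>xn\<close> and \<open>xnm\<close> are \<open>- t\<close>
  and \<open>t\<close> for every \<open>t\<close>; the second term for \<open>x1\<close> fixes
  \<open>t\<close>. The bound n on the sum makes the first term for \<open>xnm\<close> the smaller
  one.\<close>

lemma solves_S_zero:
  assumes "valid_params n m a" and "real n \<le> (\<Sum>i = 1..n + m. a i)"
  defines "t \<equiv> real n - a n - b1 n m a"
  shows "solves_S n m a 0 (a n - 1, - t, a (n + m), t)"
proof -
  have "n \<ge> 1" "m \<ge> 1"
    using assms by (auto simp: valid_params_def)
  then show ?thesis
    using assms(2) sum_params_bounds(2)[OF assms(1)] sum_params_split[of n m a]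
    unfolding solves_S_def t_def
    by (simp add: bbar1_eq bbar2_eq abar_def)
qed

text \<open>Whether a minimum vanishes depends only on the signs of its terms.\<close>

lemma min_eq_0_scale_iff:
  fixes x y z k l :: real
  assumes "k > 0" "l > 0"
  shows "min x (min y z) = 0 \<longleftrightarrow> min (k * x) (min (l * y) (k * z)) = 0"
proof -
  have min_eq_0: "min u (min v w) = 0 \<longleftrightarrow> 0 \<le> u \<and> 0 \<le> v \<and> 0 \<le> w \<and> (u = 0 \<or> v = 0 \<or> w = 0)"
    for u v w :: real
    by (auto simp: min_def)
  show ?thesis
    using assms by (auto simp: min_eq_0 zero_le_mult_iff)
qed

theorem theorem2:
  fixes n m :: nat and a :: "nat \<Rightarrow> real" and d r \<rho> :: real
  assumes "valid_params n m a"
    and "d = density n m a" and "r = ratio n m" and "\<rho> = rho n m"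
  shows "\<exists>(lam::real) (x :: real \<times> real \<times> real \<times> real).
    solves_S n m a lam x \<and>
    0 = max (min (d - (1 + \<rho>) * lam) (min (1 / 4 - lam) (r - d - (2 * r - 1 + \<rho>) * lam))) (- lam)"
proof -
  have nm: "n \<ge> 1" "m \<ge> 1"
    using assms(1) by (auto simp: valid_params_def)
  define s where "s = (\<Sum>i = 1..n + m. a i)"
  define K where "K = real n + real m - 1"
  have K: "K > 0"
    using nm by (simp add: K_def)
  have d: "d = s / K" and r: "r = real n / K" and \<rho>: "\<rho> = 1 / K"
    by (simp_all add: assms density_def ratio_def rho_def s_def K_def)
  define f where "f lam = min (d - (1 + \<rho>) * lam)
    (min (1 / 4 - lam) (r - d - (2 * r - 1 + \<rho>) * lam))" for lam
  have scale: "K * (d - (1 + \<rho>) * lam) = s - (real n + real m) * lam"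
    "4 * (1 / 4 - lam) = 1 - 4 * lam"
    "K * (r - d - (2 * r - 1 + \<rho>) * lam) = real n - s - (real n - real m + 2) * lam" for lam
    using K unfolding d r \<rho> by (simp_all add: field_simps) (simp_all add: K_def algebra_simps)
  have root_iff: "f lam = 0 \<longleftrightarrow> min (s - (real n + real m) * lam)
      (min (1 - 4 * lam) (real n - s - (real n - real m + 2) * lam)) = 0" for lam
    unfolding f_def by (subst min_eq_0_scale_iff[OF K, of 4]) (simp_all only: scale)
  have root_solves: "\<exists>x. solves_S n m a lam x" if "0 \<le> lam" "f lam = 0" for lam
  proof -
    have "lam \<le> 1 / 4"
      using that(2) by (simp add: f_def min_def split: if_splits)
    then show ?thesis
      using that(1) solves_S_if_root[OF nm s_def _ _ that(2)[unfolded root_iff]] by blast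
  qed
  have "\<exists>lam x. solves_S n m a lam x \<and> 0 = max (f lam) (- lam)"
  proof (cases "f 0 \<le> 0")
    case True
    \<comment> \<open>The term \<open>- lam\<close> absorbs a negative \<open>f 0\<close>, so any
      solution with lambda = 0 will do.\<close>
    obtain x where "solves_S n m a 0 x"
    proof (cases "real n \<le> s")
      case True
      then show ?thesis
        using that solves_S_zero[OF assms(1)] by (auto simp: s_def)
    next
      case False
      \<comment> \<open>The terms of \<open>f 0\<close> are d, 1/4 and r - d; with the last two
        positive, \<open>f 0 \<le> 0\<close> forces d = 0.\<close>
      have "0 < r - d"
        using False K by (simp add: r d divide_strict_right_mono)
      moreover have "0 \<le> d"
        using sum_params_bounds(1)[OF assms(1)] K by (simp add: d s_def)
      ultimately have "f 0 = 0"
        using True by (auto simp: f_def min_def split: if_splits)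
      then show ?thesis
        using that root_solves by blast
    qed
    moreover have "0 = max (f 0) (- 0)"
      using True by simp
    ultimately show ?thesis
      by blast
  next
    case False
    \<comment> \<open>At 1/4 the middle term of \<open>f\<close> vanishes, so \<open>f\<close> is
      nonpositive there.\<close>
    have "\<exists>lam\<ge>0. lam \<le> 1 / 4 \<and> f lam = 0"
      by (rule IVT2') (use False in \<open>auto simp: f_def intro!: continuous_intros\<close>)
    then obtain lam where lam: "0 \<le> lam" "f lam = 0"
      by blast
    then have "0 = max (f lam) (- lam)"
      by simp
    then show ?thesis
      using root_solves[OF lam] by blast
  qed
  then show ?thesis
    by (simp only: f_def)
qed

end
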